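(* For each $i\in\{0,1,2\}$, the $\mathcal{C}_i$-reflection preserves products in the category of semitopological monoids with open shifts: for every family $\{S_j\}_{j\in J}$ of semitopological monoids with open shifts, $\mathcal{C}_i\left(\prod_{j\in J}S_j\right)=\prod_{j\in J}\mathcal{C}_i(S_j)$.
   Context: A semitopological monoid is a monoid $S$ with a topology (no separation axiom assumed) such that for every $a\in S$ the shifts $x\mapsto ax$ and $x\mapsto xa$ are continuous; it has open shifts if moreover $aU$ and $Ua$ are open for every $a\in S$ and every open $U\subseteq S$. $\mathcal{C}_0,\mathcal{C}_1,\mathcal{C}_2$ denote the classes of $T_0$, $T_1$, $T_2$ spaces. Each such class $\mathcal{C}$ is epireflective in the category of topological spaces: for each space $X$ there is a space $\mathcal{C}(X)\in\mathcal{C}$ and a continuous surjection $\varphi_{(\mathcal{C},X)}\colon X\to\mathcal{C}(X)$ (the $\mathcal{C}$-reflection) such that every continuous map $f\colon X\to Y$ with $Y\in\mathcal{C}$ factors as $f=g\circ\varphi_{(\mathcal{C},X)}$ for a unique continuous $g$. Products carry the product topology. The equality $\mathcal{C}(\prod_j S_j)=\prod_j\mathcal{C}(S_j)$ means that the canonical continuous map $k\colon\mathcal{C}(\prod_j S_j)\to\prod_j\mathcal{C}(S_j)$ with $k\circ\varphi_{(\mathcal{C},\prod_j S_j)}=\prod_j\varphi_{(\mathcal{C},S_j)}$ is a homeomorphism. *)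

theory Defs
  imports "HOL-Analysis.Analysis" "HOL-Algebra.Product_Groups"
begin

locale semitop_monoid = monoid M for M (structure) and T :: "'a topology" +
  assumes topspace_eq_carrier: "topspace T = carrier M"
    and continuous_left_shift: "a \<in> carrier M \<Longrightarrow> continuous_map T T (\<lambda>x. a \<otimes> x)"
    and continuous_right_shift: "a \<in> carrier M \<Longrightarrow> continuous_map T T (\<lambda>x. x \<otimes> a)"

locale semitop_monoid_open_shifts = semitop_monoid +
  assumes open_left_shift: "a \<in> carrier M \<Longrightarrow> open_map T T (\<lambda>x. a \<otimes> x)"
    and open_right_shift: "a \<in> carrier M \<Longrightarrow> open_map T T (\<lambda>x. x \<otimes> a)"

definition sep_class :: "nat \<Rightarrow> 'a topology \<Rightarrow> bool" where
  "sep_class i X \<longleftrightarrow>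
     i = 0 \<and> t0_space X \<or> i = 1 \<and> t1_space X \<or> i = 2 \<and> Hausdorff_space X"

text \<open>The pair \<open>(R, \<phi>)\<close> is a reflection of \<open>X\<close> in the class number \<open>i\<close>.
  A definition cannot quantify over types, so the test spaces \<open>Y\<close> range over topologies on
  \<open>'a set\<close>. This type can accommodate every quotient of \<open>X\<close>, and the classes are closed
  under subspaces, so nothing is lost: lemma \<open>reflection_universal\<close> below gives the universal
  property for test spaces of every type. The map \<open>g\<close> is taken extensional on \<open>topspace R\<close>
  because HOL functions are total, so it could only be unique there.\<close>

definition reflection :: "nat \<Rightarrow> 'a topology \<Rightarrow> 'r topology \<Rightarrow> ('a \<Rightarrow> 'r) \<Rightarrow> bool" where
  "reflection i X R \<phi> \<longleftrightarrow>
     sep_class i R \<and> continuous_map X R \<phi> \<and> \<phi> ` topspace X = topspace R \<and>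
     (\<forall>(Y :: 'a set topology) f. sep_class i Y \<and> continuous_map X Y f \<longrightarrow>
        (\<exists>!g. g \<in> extensional (topspace R) \<and> continuous_map R Y g \<and>
              (\<forall>x\<in>topspace X. f x = g (\<phi> x))))"

lemma sep_class_if_separated:
  fixes X :: "'a topology"
  assumes i: "i \<in> {0, 1, 2}"
    and sep: "\<And>c d. c \<in> topspace X \<Longrightarrow> d \<in> topspace X \<Longrightarrow> c \<noteq> d \<Longrightarrow>
      \<exists>(Y :: 'b topology) g. sep_class i Y \<and> continuous_map X Y g \<and> g c \<noteq> g d"
  shows "sep_class i X"
proof -
  have img: "g c \<in> topspace Y" if "continuous_map X Y g" "c \<in> topspace X"
    for Y :: "'b topology" and g c
    using that by (auto simp: continuous_map_def)
  consider "i = 0" | "i = 1" | "i = 2" using i by auto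
  then show ?thesis
  proof cases
    case 1
    have "t0_space X"
      unfolding t0_space_def
    proof (intro ballI impI)
      fix c d assume cd: "c \<in> topspace X" "d \<in> topspace X" "c \<noteq> d"
      then obtain Y :: "'b topology" and g where
        Y: "t0_space Y" and g: "continuous_map X Y g" and ne: "g c \<noteq> g d"
        using sep[of c d] 1 by (auto simp: sep_class_def)
      obtain U where "openin Y U" "g c \<notin> U \<longleftrightarrow> g d \<in> U"
        using Y ne img[OF g cd(1)] img[OF g cd(2)] unfolding t0_space_def by meson
      then show "\<exists>U. openin X U \<and> (c \<notin> U) = (d \<in> U)"
        using cd openin_continuous_map_preimage[OF g, of U]
        by (intro exI[of _ "{c \<in> topspace X. g c \<in> U}"]) auto
    qed
    then show ?thesis using 1 by (simp add: sep_class_def)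
  next
    case 2
    have "\<exists>U. openin X U \<and> c \<in> U \<and> d \<notin> U"
      if cd: "c \<in> topspace X" "d \<in> topspace X" "c \<noteq> d" for c d
    proof -
      obtain Y :: "'b topology" and g where
        Y: "t1_space Y" and g: "continuous_map X Y g" and ne: "g c \<noteq> g d"
        using sep[OF cd] 2 by (auto simp: sep_class_def)
      obtain U where "openin Y U" "g c \<in> U" "g d \<notin> U"
        using Y ne img[OF g cd(1)] img[OF g cd(2)] unfolding t1_space_def by meson
      then show ?thesis
        using cd openin_continuous_map_preimage[OF g, of U]
        by (intro exI[of _ "{c \<in> topspace X. g c \<in> U}"]) auto
    qed
    then have "t1_space X" unfolding t1_space_def by blast
    then show ?thesis using 2 by (simp add: sep_class_def)
  next
    case 3
    have "\<exists>U V. openin X U \<and> openin X V \<and> c \<in> U \<and> d \<in> V \<and> disjnt U V"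
      if cd: "c \<in> topspace X" "d \<in> topspace X" "c \<noteq> d" for c d
    proof -
      obtain Y :: "'b topology" and g where
        Y: "Hausdorff_space Y" and g: "continuous_map X Y g" and ne: "g c \<noteq> g d"
        using sep[OF cd] 3 by (auto simp: sep_class_def)
      obtain U V where "openin Y U" "openin Y V" "g c \<in> U" "g d \<in> V" "disjnt U V"
        using Y ne img[OF g cd(1)] img[OF g cd(2)] unfolding Hausdorff_space_def by meson
      then show ?thesis
        using cd openin_continuous_map_preimage[OF g, of U]
          openin_continuous_map_preimage[OF g, of V]
        by (intro exI[of _ "{c \<in> topspace X. g c \<in> U}"] exI[of _ "{c \<in> topspace X. g c \<in> V}"])
           (auto simp: disjnt_iff)
    qed
    then have "Hausdorff_space X" unfolding Hausdorff_space_def by blast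
    then show ?thesis using 3 by (simp add: sep_class_def)
  qed
qed

lemma reflection_universal:
  fixes Y :: "'b topology"
  assumes refl: "reflection i X R \<phi>" and Y: "sep_class i Y" and f: "continuous_map X Y f"
  shows "\<exists>!g. g \<in> extensional (topspace R) \<and> continuous_map R Y g \<and>
              (\<forall>x\<in>topspace X. f x = g (\<phi> x))"
proof -
  define q where "q x = {x' \<in> topspace X. f x' = f x}" for x
  define p where "p c = f (SOME x. x \<in> c)" for c
  have pq: "p (q x) = f x" if "x \<in> topspace X" for x
  proof -
    have "(SOME x'. x' \<in> q x) \<in> q x"
      using that by (intro someI[of "\<lambda>x'. x' \<in> q x" x]) (auto simp: q_def)
    then show ?thesis by (auto simp: p_def q_def)
  qed
  have fX: "f ` topspace X \<subseteq> topspace Y"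
    using f by (auto simp: continuous_map_def)
  define Z where "Z = pullback_topology (q ` topspace X) p Y"
  have topZ: "topspace Z = q ` topspace X"
    using fX pq by (auto simp: Z_def topspace_pullback_topology)
  have p: "continuous_map Z Y p"
    using continuous_map_pullback[OF continuous_map_id, of "q ` topspace X" p Y] by (simp add: Z_def)
  have "inj_on p (topspace Z)"
    unfolding topZ inj_on_def using pq by (auto simp: q_def)
  then have sepZ: "sep_class i Z"
    using Y p by (intro sep_class_if_separated) (auto simp: sep_class_def inj_on_def)
  have "continuous_map X Y (p \<circ> q)"
    by (rule continuous_map_eq[OF f]) (simp add: pq)
  then have "continuous_map X Z q"
    unfolding Z_def by (rule continuous_map_pullback') auto
  then obtain g where g: "continuous_map R Z g" "\<And>x. x \<in> topspace X \<Longrightarrow> q x = g (\<phi> x)"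
    using refl sepZ unfolding reflection_def by metis
  have surj: "\<phi> ` topspace X = topspace R"
    using refl by (auto simp: reflection_def)
  show ?thesis
  proof (rule ex1I)
    let ?h = "restrict (p \<circ> g) (topspace R)"
    have "continuous_map R Y ?h"
      by (rule continuous_map_eq[OF continuous_map_compose[OF g(1) p]]) simp
    moreover have "f x = ?h (\<phi> x)" if "x \<in> topspace X" for x
      using that surj g(2) pq by (metis comp_apply imageI restrict_apply)
    ultimately show "?h \<in> extensional (topspace R) \<and> continuous_map R Y ?h \<and>
        (\<forall>x\<in>topspace X. f x = ?h (\<phi> x))" by simp
  next
    fix h assume h: "h \<in> extensional (topspace R) \<and> continuous_map R Y h \<and>
        (\<forall>x\<in>topspace X. f x = h (\<phi> x))"
    show "h = restrict (p \<circ> g) (topspace R)"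
    proof (rule extensionalityI)
      fix y assume "y \<in> topspace R"
      then obtain x where "x \<in> topspace X" "y = \<phi> x" using surj by blast
      then show "h y = restrict (p \<circ> g) (topspace R) y"
        using h g(2) pq \<open>y \<in> topspace R\<close> by (metis comp_apply restrict_apply)
    qed (use h in auto)
  qed
qed

lemma reflection_exists:
  fixes X :: "'a topology"
  assumes i: "i \<in> {0, 1, 2}"
  shows "\<exists>(R :: 'a set topology) \<phi>. reflection i X R \<phi>"
proof -
  define E where "E x y \<longleftrightarrow> (\<forall>(Y :: 'a set topology) f.
     sep_class i Y \<and> continuous_map X Y f \<longrightarrow> f x = f y)" for x y
  define \<phi> where "\<phi> x = {y \<in> topspace X. E x y}" for x
  have eq: "\<phi> x = \<phi> y \<longleftrightarrow> E x y" if "x \<in> topspace X" "y \<in> topspace X" for x y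
  proof
    assume "\<phi> x = \<phi> y"
    moreover have "y \<in> \<phi> y" using that by (simp add: \<phi>_def E_def)
    ultimately show "E x y" by (auto simp: \<phi>_def)
  next
    assume "E x y"
    then have "E x z \<longleftrightarrow> E y z" for z unfolding E_def by metis
    then show "\<phi> x = \<phi> y" by (simp add: \<phi>_def)
  qed
  define Q where "Q = topology (\<lambda>U. U \<subseteq> \<phi> ` topspace X \<and> openin X {x \<in> topspace X. \<phi> x \<in> U})"
  have "istopology (\<lambda>U. U \<subseteq> \<phi> ` topspace X \<and> openin X {x \<in> topspace X. \<phi> x \<in> U})"
    unfolding istopology_def
  proof (intro conjI allI impI)
    fix S U assume SU: "S \<subseteq> \<phi> ` topspace X \<and> openin X {x \<in> topspace X. \<phi> x \<in> S}"
      "U \<subseteq> \<phi> ` topspace X \<and> openin X {x \<in> topspace X. \<phi> x \<in> U}"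
    have *: "{x \<in> topspace X. \<phi> x \<in> S \<inter> U} =
      {x \<in> topspace X. \<phi> x \<in> S} \<inter> {x \<in> topspace X. \<phi> x \<in> U}" by auto
    show "openin X {x \<in> topspace X. \<phi> x \<in> S \<inter> U}"
      unfolding * using SU by auto
    show "S \<inter> U \<subseteq> \<phi> ` topspace X" using SU by auto
  next
    fix K assume K: "\<forall>S\<in>K. S \<subseteq> \<phi> ` topspace X \<and> openin X {x \<in> topspace X. \<phi> x \<in> S}"
    have *: "{x \<in> topspace X. \<phi> x \<in> \<Union>K} = (\<Union>S\<in>K. {x \<in> topspace X. \<phi> x \<in> S})" by auto
    show "openin X {x \<in> topspace X. \<phi> x \<in> \<Union>K}"
      unfolding * using K by (intro openin_Union) auto
    show "\<Union>K \<subseteq> \<phi> ` topspace X" using K by auto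
  qed
  then have openQ: "openin Q U \<longleftrightarrow> U \<subseteq> \<phi> ` topspace X \<and> openin X {x \<in> topspace X. \<phi> x \<in> U}" for U
    by (simp add: Q_def topology_inverse')
  have "openin Q (\<phi> ` topspace X)"
    unfolding openQ by (auto intro: openin_subopen[THEN iffD2])
  then have topQ: "topspace Q = \<phi> ` topspace X"
    using openQ by (metis openin_subset openin_topspace subset_antisym)
  have \<phi>: "continuous_map X Q \<phi>"
    unfolding continuous_map_def topQ openQ by auto
  have factor: "\<exists>g. g \<in> extensional (topspace Q) \<and> continuous_map Q Y g \<and>
      (\<forall>x\<in>topspace X. f x = g (\<phi> x))"
    if Y: "sep_class i Y" and f: "continuous_map X Y f" for Y :: "'a set topology" and f
  proof -
    define g where "g = restrict (\<lambda>c. f (SOME x. x \<in> c)) (topspace Q)"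
    have g: "f x = g (\<phi> x)" if x: "x \<in> topspace X" for x
    proof -
      have "x \<in> \<phi> x" using x by (simp add: \<phi>_def E_def)
      then have "(SOME y. y \<in> \<phi> x) \<in> \<phi> x" by (rule someI)
      then show ?thesis
        using x Y f by (auto simp: g_def topQ \<phi>_def E_def)
    qed
    have "continuous_map Q Y g"
      unfolding continuous_map_def
    proof (intro conjI allI impI)
      show "g \<in> topspace Q \<rightarrow> topspace Y"
      proof
        fix c assume "c \<in> topspace Q"
        then obtain x where x: "x \<in> topspace X" "c = \<phi> x" unfolding topQ by blast
        then have "g c = f x" using g by simp
        then show "g c \<in> topspace Y" using f x by (auto simp: continuous_map_def)
      qed
      fix U assume U: "openin Y U"
      have "{x \<in> topspace X. \<phi> x \<in> {c \<in> topspace Q. g c \<in> U}} = {x \<in> topspace X. f x \<in> U}"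
        using g by (auto simp: topQ)
      then show "openin Q {c \<in> topspace Q. g c \<in> U}"
        unfolding openQ using openin_continuous_map_preimage[OF f U] by (auto simp: topQ)
    qed
    then show ?thesis using g by (auto simp: g_def)
  qed
  have sepQ: "sep_class i Q"
  proof (rule sep_class_if_separated[OF i])
    fix c d assume cd: "c \<in> topspace Q" "d \<in> topspace Q" "c \<noteq> d"
    then obtain x y where xy: "x \<in> topspace X" "y \<in> topspace X" "c = \<phi> x" "d = \<phi> y"
      unfolding topQ by blast
    then obtain Y :: "'a set topology" and f where
      "sep_class i Y" "continuous_map X Y f" "f x \<noteq> f y"
      using cd(3) eq unfolding E_def by metis
    then show "\<exists>(Y :: 'a set topology) g. sep_class i Y \<and> continuous_map Q Y g \<and> g c \<noteq> g d"
      using factor xy by metis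
  qed
  have unique: "g = h"
    if "g \<in> extensional (topspace Q)" "h \<in> extensional (topspace Q)"
      "\<forall>x\<in>topspace X. f x = g (\<phi> x)" "\<forall>x\<in>topspace X. f x = h (\<phi> x)"
    for f :: "'a \<Rightarrow> 'a set" and g h
    using that(1,2) by (rule extensionalityI) (use that(3,4) topQ in auto)
  have "reflection i X Q \<phi>"
    unfolding reflection_def
  proof (intro conjI allI impI)
    fix Y :: "'a set topology" and f
    assume "sep_class i Y \<and> continuous_map X Y f"
    then show "\<exists>!g. g \<in> extensional (topspace Q) \<and> continuous_map Q Y g \<and>
        (\<forall>x\<in>topspace X. f x = g (\<phi> x))"
      using factor unique by (intro ex_ex1I) blast+
  qed (use sepQ \<phi> topQ in auto)
  then show ?thesis by blast
qed

text \<open>The product carries the coordinatewise multiplication and the product topology. It is again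
  a semitopological monoid, but for infinite \<open>J\<close> its shifts need not be open.\<close>

lemma semitop_monoid_product:
  assumes S: "\<And>j. j \<in> J \<Longrightarrow> semitop_monoid (S j) (T j)"
  shows "semitop_monoid (product_group J S) (product_topology T J)"
proof -
  have mon: "monoid (S j)" and top: "topspace (T j) = carrier (S j)" if "j \<in> J" for j
    using S[OF that] by (auto simp: semitop_monoid_def semitop_monoid_axioms_def)
  have "monoid (product_group J S)"
  proof (rule monoidI)
    fix x y z assume "x \<in> carrier (product_group J S)" "y \<in> carrier (product_group J S)"
      "z \<in> carrier (product_group J S)"
    then show "x \<otimes>\<^bsub>product_group J S\<^esub> y \<otimes>\<^bsub>product_group J S\<^esub> z =
        x \<otimes>\<^bsub>product_group J S\<^esub> (y \<otimes>\<^bsub>product_group J S\<^esub> z)"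
      using mon by (auto simp: PiE_iff monoid.m_assoc intro!: restrict_ext)
  next
    fix x assume x: "x \<in> carrier (product_group J S)"
    show "\<one>\<^bsub>product_group J S\<^esub> \<otimes>\<^bsub>product_group J S\<^esub> x = x"
      using x mon by (intro ext) (auto simp: PiE_iff extensional_def)
    show "x \<otimes>\<^bsub>product_group J S\<^esub> \<one>\<^bsub>product_group J S\<^esub> = x"
      using x mon by (intro ext) (auto simp: PiE_iff extensional_def)
  qed (use mon in \<open>auto simp: PiE_iff monoid.m_closed\<close>)
  moreover have "semitop_monoid_axioms (product_group J S) (product_topology T J)"
  proof
    show "topspace (product_topology T J) = carrier (product_group J S)"
      using top by (auto simp: PiE_iff)
  next
    fix a assume "a \<in> carrier (product_group J S)"
    then have a: "a j \<in> carrier (S j)" if "j \<in> J" for j using that by auto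
    have L: "continuous_map (T j) (T j) (\<lambda>x. a j \<otimes>\<^bsub>S j\<^esub> x)"
      and R: "continuous_map (T j) (T j) (\<lambda>x. x \<otimes>\<^bsub>S j\<^esub> a j)" if "j \<in> J" for j
      using semitop_monoid.continuous_left_shift[OF S[OF that] a[OF that]]
        semitop_monoid.continuous_right_shift[OF S[OF that] a[OF that]] by auto
    have P: "continuous_map (product_topology T J) (T j) (\<lambda>x. x j)" if "j \<in> J" for j
      using that by (rule continuous_map_product_projection)
    show "continuous_map (product_topology T J) (product_topology T J)
        (\<lambda>x. a \<otimes>\<^bsub>product_group J S\<^esub> x)"
      using continuous_map_compose[OF P L] by (auto simp: continuous_map_componentwise o_def)
    show "continuous_map (product_topology T J) (product_topology T J)
        (\<lambda>x. x \<otimes>\<^bsub>product_group J S\<^esub> a)"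
      using continuous_map_compose[OF P R] by (auto simp: continuous_map_componentwise o_def)
  qed
  ultimately show ?thesis by (simp add: semitop_monoid_def)
qed

end

theory Submission
  imports Defs
begin

text \<open>The kernel of the reflection map \<open>\<phi>\<close> of a semitopological monoid is a congruence, by the universal
  property. If \<open>\<phi> y = \<phi> u\<close> with \<open>u\<close> in an open set \<open>U\<close>, then \<open>V = {v. v u \<in> U}\<close> is open and
  contains \<open>1\<close>, and the open set \<open>V y\<close> is mapped by \<open>\<phi>\<close> into \<open>\<phi> U\<close>; hence \<open>\<phi>\<close> is open. So the
  product \<open>\<Phi>\<close> of the reflection maps is an open surjection. A continuous map from the product into
  a space of the class is constant on the fibres of \<open>\<Phi>\<close>: changing finitely many coordinates within
  fibres does not change its value, and the remaining coordinates are handled by continuity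
  and \<open>T\<^sub>0\<close> separation. Hence every such map factors continuously through \<open>\<Phi>\<close>.\<close>

section \<open>Separation classes and consequences of the universal property\<close>

lemma sep_class_imp_t0_space: "sep_class i X \<Longrightarrow> t0_space X"
  by (auto simp: sep_class_def t1_imp_t0_space Hausdorff_imp_t0_space)

lemma sep_class_product_topology:
  fixes R :: "'j \<Rightarrow> 'r topology"
  assumes i: "i \<in> {0, 1, 2}" and R: "\<And>j. j \<in> J \<Longrightarrow> sep_class i (R j)"
  shows "sep_class i (product_topology R J)"
proof (rule sep_class_if_separated[OF i])
  fix c d
  assume cd: "c \<in> topspace (product_topology R J)" "d \<in> topspace (product_topology R J)" "c \<noteq> d"
  then obtain j where "j \<in> J" "c j \<noteq> d j"
    by (metis PiE_ext topspace_product_topology)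
  then show "\<exists>(Y :: 'r topology) g. sep_class i Y \<and> continuous_map (product_topology R J) Y g \<and>
      g c \<noteq> g d"
    using R by (intro exI[of _ "R j"] exI[of _ "\<lambda>x. x j"]) auto
qed

lemma reflection_continuous: "reflection i X R \<phi> \<Longrightarrow> continuous_map X R \<phi>"
  and reflection_image: "reflection i X R \<phi> \<Longrightarrow> \<phi> ` topspace X = topspace R"
  and reflection_sep_class: "reflection i X R \<phi> \<Longrightarrow> sep_class i R"
  by (simp_all add: reflection_def)

lemma reflection_factor:
  assumes "reflection i X R \<phi>" "sep_class i Y" "continuous_map X Y f"
  obtains g where "continuous_map R Y g" "\<And>x. x \<in> topspace X \<Longrightarrow> f x = g (\<phi> x)"
  using reflection_universal[OF assms] by blast

lemma reflection_eq_imp_eq: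
  assumes "reflection i X R \<phi>" "sep_class i Y" "continuous_map X Y f"
    and "x \<in> topspace X" "y \<in> topspace X" "\<phi> x = \<phi> y"
  shows "f x = f y"
  by (metis assms reflection_factor)

text \<open>Lets openness in \<open>R\<close> be tested on preimages in \<open>X\<close>, although a
  reflection is characterised only by maps out of it.\<close>

lemma reflection_quotient_map:
  fixes R :: "'r topology"
  assumes i: "i \<in> {0, 1, 2}" and refl: "reflection i X R \<phi>"
  shows "quotient_map X R \<phi>"
proof -
  note cont = reflection_continuous[OF refl] and img = reflection_image[OF refl]
  have "openin R V" if V: "V \<subseteq> topspace R" "openin X {x \<in> topspace X. \<phi> x \<in> V}" for V
  proof -
    \<comment> \<open>Adjoining \<open>V\<close> to the topology of \<open>R\<close> stays in the class and keeps \<open>\<phi>\<close> continuous.\<close>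
    define Q where "Q = topology_generated_by (insert V {U. openin R U})"
    have openQ: "openin Q U" if "U = V \<or> openin R U" for U
      using that unfolding Q_def by (intro topology_generated_by_Basis) auto
    have topQ: "topspace Q = topspace R"
      using V(1) by (auto simp: Q_def topology_generated_by_topspace dest: openin_subset)
    \<comment> \<open>The identity is a continuous injection of \<open>Q\<close> into a space of the
      class, so its values in \<open>R\<close> separate the points of \<open>Q\<close>.\<close>
    have "continuous_map Q R (\<lambda>x. x)"
      using openQ by (simp add: continuous_map_openin_preimage_eq topQ Int_absorb1 openin_subset)
    then have sepQ: "sep_class i Q"
      using reflection_sep_class[OF refl]
      by (intro sep_class_if_separated[OF i] exI[of _ R] exI[of _ "\<lambda>x. x"]) auto
    have "continuous_map X Q \<phi>"
      unfolding Q_def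
    proof (rule continuous_on_generated_topo)
      fix U assume "U \<in> insert V {U. openin R U}"
      then have "openin X {x \<in> topspace X. \<phi> x \<in> U}"
        using V(2) openin_continuous_map_preimage[OF cont] by auto
      then show "openin X (\<phi> -` U \<inter> topspace X)"
        by (simp add: vimage_def Int_def conj_commute)
    qed (use img in auto)
    then obtain g where g: "continuous_map R Q g" "\<And>x. x \<in> topspace X \<Longrightarrow> \<phi> x = g (\<phi> x)"
      using reflection_factor[OF refl sepQ] by metis
    \<comment> \<open>Since \<phi> is onto, the factor \<open>g\<close> is the identity on
      \<open>R\<close>; its continuity into \<open>Q\<close> then says that \<open>V\<close> was
      already open in \<open>R\<close>.\<close>
    then have "g y = y" if "y \<in> topspace R" for y
      using that img by (metis imageE)
    then have "{y \<in> topspace R. g y \<in> V} = V"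
      using V(1) by auto
    then show ?thesis
      using openin_continuous_map_preimage[OF g(1) openQ[of V]] by simp
  qed
  then show ?thesis
    unfolding quotient_map_def using img openin_continuous_map_preimage[OF cont]
    by (intro conjI allI impI iffI) simp_all
qed

section \<open>Reflection maps of semitopological monoids\<close>

context semitop_monoid
begin

text \<open>A left shift followed by \<phi> is a continuous map into a space of the class, hence
  constant on the fibres of \<phi>.\<close>

lemma reflection_congruence:
  assumes refl: "reflection i T R \<phi>"
    and a: "a \<in> carrier M" and xy: "x \<in> carrier M" "y \<in> carrier M" "\<phi> x = \<phi> y"
  shows "\<phi> (a \<otimes> x) = \<phi> (a \<otimes> y)"
  using reflection_eq_imp_eq[OF refl reflection_sep_class[OF refl]
      continuous_map_compose[OF continuous_left_shift[OF a] reflection_continuous[OF refl]],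
      of x y] xy
  by (simp add: topspace_eq_carrier)

end

context semitop_monoid_open_shifts
begin

lemma reflection_open_map:
  assumes i: "i \<in> {0, 1, 2}" and refl: "reflection i T R \<phi>"
  shows "open_map T R \<phi>"
  unfolding open_map_def
proof (intro allI impI)
  fix U assume U: "openin T U"
  then have UM: "U \<subseteq> carrier M"
    using openin_subset topspace_eq_carrier by blast
  \<comment> \<open>As \<phi> is a quotient map, it suffices that the saturation of \<open>U\<close>
    is a neighbourhood of each of its points.\<close>
  have "\<exists>W. openin T W \<and> y \<in> W \<and> W \<subseteq> {x \<in> topspace T. \<phi> x \<in> \<phi> ` U}"
    if y: "y \<in> {x \<in> topspace T. \<phi> x \<in> \<phi> ` U}" for y
  proof -
    obtain u where u: "u \<in> U" "\<phi> y = \<phi> u" and yM: "y \<in> carrier M"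
      using y topspace_eq_carrier by auto
    with UM have uM: "u \<in> carrier M" by auto
    define V where "V = {v \<in> carrier M. v \<otimes> u \<in> U}"
    have "openin T V"
      using openin_continuous_map_preimage[OF continuous_right_shift[OF uM] U]
      by (simp add: V_def topspace_eq_carrier)
    then have "openin T ((\<lambda>v. v \<otimes> y) ` V)"
      using open_right_shift[OF yM] by (simp add: open_map_def)
    moreover have "\<one> \<in> V"
      using u uM by (simp add: V_def)
    then have "y \<in> (\<lambda>v. v \<otimes> y) ` V"
      using yM by (metis image_eqI l_one)
    \<comment> \<open>By the congruence property, \<open>v \<otimes> y\<close> has the same image as
      \<open>v \<otimes> u\<close>, which lies in \<open>U\<close>.\<close>
    moreover have "v \<otimes> y \<in> carrier M \<and> \<phi> (v \<otimes> y) \<in> \<phi> ` U" if "v \<in> V" for v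
      using that reflection_congruence[OF refl _ yM uM u(2), of v] yM by (auto simp: V_def)
    ultimately show ?thesis
      by (intro exI[of _ "(\<lambda>v. v \<otimes> y) ` V"]) (auto simp: topspace_eq_carrier)
  qed
  then have "openin T {x \<in> topspace T. \<phi> x \<in> \<phi> ` U}"
    by (subst openin_subopen) blast
  moreover have "\<phi> ` U \<subseteq> topspace R"
    using UM topspace_eq_carrier reflection_image[OF refl] by blast
  ultimately show "openin R (\<phi> ` U)"
    using reflection_quotient_map[OF i refl] unfolding quotient_map_def by blast
qed

end

section \<open>Products of open maps\<close>

lemma restrict_image_PiE:
  "(\<lambda>x. \<lambda>j\<in>J. \<phi> j (x j)) ` (\<Pi>\<^sub>E j\<in>J. U j) = (\<Pi>\<^sub>E j\<in>J. \<phi> j ` U j)" (is "?L = ?R")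
proof
  show "?R \<subseteq> ?L"
  proof
    fix r assume r: "r \<in> ?R"
    then have "\<forall>j\<in>J. \<exists>a. a \<in> U j \<and> r j = \<phi> j a" by (auto simp: PiE_iff)
    then obtain x where x: "\<And>j. j \<in> J \<Longrightarrow> x j \<in> U j \<and> r j = \<phi> j (x j)" by metis
    have "r = (\<lambda>j\<in>J. \<phi> j (restrict x J j))"
    proof
      show "r j = (\<lambda>j\<in>J. \<phi> j (restrict x J j)) j" for j
        using x PiE_arb[OF r] by (cases "j \<in> J") simp_all
    qed
    moreover have "restrict x J \<in> (\<Pi>\<^sub>E j\<in>J. U j)" using x by simp
    ultimately show "r \<in> ?L" by (rule image_eqI)
  qed
qed auto

lemma openin_product_topologyE:
  assumes "openin (product_topology X I) S" "x \<in> S"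
  obtains U where "finite {i \<in> I. U i \<noteq> topspace (X i)}" "\<And>i. i \<in> I \<Longrightarrow> openin (X i) (U i)"
    "x \<in> Pi\<^sub>E I U" "Pi\<^sub>E I U \<subseteq> S"
proof -
  have "\<exists>U. finite {i \<in> I. U i \<noteq> topspace (X i)} \<and> (\<forall>i\<in>I. openin (X i) (U i)) \<and>
      x \<in> Pi\<^sub>E I U \<and> Pi\<^sub>E I U \<subseteq> S"
    using assms unfolding openin_product_topology_alt by (rule bspec)
  then show thesis
    by (elim exE conjE) (rule that, assumption, erule bspec, assumption+)
qed

text \<open>Surjectivity sends a full factor to a full factor, so the image of a basic open box
  again has only finitely many proper factors.\<close>

lemma open_map_product_topology:
  assumes om: "\<And>j. j \<in> J \<Longrightarrow> open_map (X j) (Y j) (\<phi> j)"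
    and surj: "\<And>j. j \<in> J \<Longrightarrow> \<phi> j ` topspace (X j) = topspace (Y j)"
  shows "open_map (product_topology X J) (product_topology Y J) (\<lambda>x. \<lambda>j\<in>J. \<phi> j (x j))"
    (is "open_map _ _ ?\<Phi>")
  unfolding open_map_def
proof (intro allI impI)
  fix W assume W: "openin (product_topology X J) W"
  show "openin (product_topology Y J) (?\<Phi> ` W)"
  proof (subst openin_subopen, intro ballI)
    fix r assume "r \<in> ?\<Phi> ` W"
    then obtain x where x: "x \<in> W" "r = ?\<Phi> x" by blast
    obtain U where U: "finite {j \<in> J. U j \<noteq> topspace (X j)}"
      "\<And>j. j \<in> J \<Longrightarrow> openin (X j) (U j)" "x \<in> Pi\<^sub>E J U" "Pi\<^sub>E J U \<subseteq> W"
      by (rule openin_product_topologyE[OF W x(1)]) (rule that)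
    have "{j \<in> J. \<phi> j ` U j \<noteq> topspace (Y j)} \<subseteq> {j \<in> J. U j \<noteq> topspace (X j)}"
      using surj by (intro Collect_mono) metis
    then have "finite {j \<in> J. \<phi> j ` U j \<noteq> topspace (Y j)}"
      using U(1) by (rule finite_subset)
    moreover have "openin (Y j) (\<phi> j ` U j)" if "j \<in> J" for j
      using om U(2) that unfolding open_map_def by metis
    ultimately have "openin (product_topology Y J) (\<Pi>\<^sub>E j\<in>J. \<phi> j ` U j)"
      by (simp add: openin_PiE_gen)
    moreover have "?\<Phi> ` Pi\<^sub>E J U = (\<Pi>\<^sub>E j\<in>J. \<phi> j ` U j)"
      by (rule restrict_image_PiE[of \<phi> J U])
    moreover have "r \<in> ?\<Phi> ` Pi\<^sub>E J U"
      using x(2) U(3) by (rule image_eqI[of r ?\<Phi> x])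
    moreover have "?\<Phi> ` Pi\<^sub>E J U \<subseteq> ?\<Phi> ` W"
      using U(4) by (rule image_mono)
    ultimately show "\<exists>V. openin (product_topology Y J) V \<and> r \<in> V \<and> V \<subseteq> ?\<Phi> ` W"
      by (intro exI[of _ "?\<Phi> ` Pi\<^sub>E J U"]) simp
  qed
qed

section \<open>Maps from a product into a space of the class\<close>

lemma continuous_map_product_topology_update:
  assumes "x \<in> topspace (product_topology X J)" "j \<in> J"
  shows "continuous_map (X j) (product_topology X J) (\<lambda>a. x(j := a))"
  using assms by (intro continuous_map_coordinatewise_then_product)
    (auto simp: PiE_iff extensional_def)

lemma product_reflections_eq_imp_eq:
  fixes X :: "'j \<Rightarrow> 'a topology"
  assumes refl: "\<And>j. j \<in> J \<Longrightarrow> reflection i (X j) (R j) (\<phi> j)"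
    and Y: "sep_class i Y" and f: "continuous_map (product_topology X J) Y f"
    and x: "x \<in> topspace (product_topology X J)" and y: "y \<in> topspace (product_topology X J)"
    and xy: "\<And>j. j \<in> J \<Longrightarrow> \<phi> j (x j) = \<phi> j (y j)"
  shows "f x = f y"
proof -
  let ?P = "product_topology X J"
  \<comment> \<open>\<open>override_on x y F\<close> takes the coordinates of \<open>y\<close> on
    \<open>F\<close> and those of \<open>x\<close> elsewhere. The points are quantified afresh
    because \<open>approx\<close> is later used with their roles exchanged.\<close>
  have finite_change: "f (override_on x y F) = f x"
    if "finite F" "F \<subseteq> J" "x \<in> topspace ?P" "y \<in> topspace ?P"
      "\<And>j. j \<in> J \<Longrightarrow> \<phi> j (x j) = \<phi> j (y j)" for F x y
    using that(1,2)
  proof (induction F rule: finite_induct)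
    case (insert j F)
    let ?z = "override_on x y F"
    have j: "j \<in> J" and z: "?z \<in> topspace ?P"
      using insert.prems that(3,4) by (auto simp: PiE_iff extensional_def override_on_def)
    \<comment> \<open>Restricting \<open>f\<close> to the slice through \<open>?z\<close> in
      direction \<open>j\<close> reduces a change of one coordinate to the reflection of
      \<open>X j\<close>.\<close>
    have "continuous_map (X j) Y (f \<circ> (\<lambda>a. ?z(j := a)))"
      using continuous_map_compose[OF continuous_map_product_topology_update[OF z j] f] .
    moreover have "y j \<in> topspace (X j)" "x j \<in> topspace (X j)" "\<phi> j (y j) = \<phi> j (x j)"
      using that(3-5) j by (auto simp: PiE_iff)
    ultimately have "(f \<circ> (\<lambda>a. ?z(j := a))) (y j) = (f \<circ> (\<lambda>a. ?z(j := a))) (x j)"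
      by (rule reflection_eq_imp_eq[OF refl[OF j] Y, where f = "f \<circ> (\<lambda>a. ?z(j := a))"])
    moreover have "override_on x y (insert j F) = ?z(j := y j)"
      by (rule override_on_insert)
    moreover have "?z(j := x j) = ?z"
      using insert.hyps by (intro fun_upd_idem) simp
    moreover have "f ?z = f x"
      using insert.IH insert.prems by blast
    ultimately show ?case by (simp only: comp_apply)
  qed auto
  have approx: "f x \<in> U"
    if U: "openin Y U" "f y \<in> U" and xy: "x \<in> topspace ?P" "y \<in> topspace ?P"
      "\<And>j. j \<in> J \<Longrightarrow> \<phi> j (x j) = \<phi> j (y j)" for U x y
  proof -
    have "y \<in> {z \<in> topspace ?P. f z \<in> U}"
      using U(2) xy(2) by simp
    then obtain B where B: "finite {j \<in> J. B j \<noteq> topspace (X j)}" "y \<in> Pi\<^sub>E J B"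
      "Pi\<^sub>E J B \<subseteq> {z \<in> topspace ?P. f z \<in> U}"
      by (rule openin_product_topologyE[OF openin_continuous_map_preimage[OF f U(1)]]) (rule that)
    let ?F = "{j \<in> J. B j \<noteq> topspace (X j)}"
    \<comment> \<open>Outside \<open>?F\<close> the box is the full factor, so the coordinates of
      \<open>x\<close> may stay there.\<close>
    have "override_on x y ?F \<in> Pi\<^sub>E J B"
      using B(2) xy(1) by (auto simp: PiE_iff extensional_def override_on_def)
    then have "f (override_on x y ?F) \<in> U"
      using B(3) by blast
    then show ?thesis
      using finite_change[OF B(1) Collect_restrict xy] by (simp only:)
  qed
  \<comment> \<open>The two values are topologically indistinguishable, so \<open>T\<^sub>0\<close>
    separation makes them equal.\<close>
  have "f x \<in> U \<longleftrightarrow> f y \<in> U" if "openin Y U" for U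
    using approx[OF that _ x y xy] approx[OF that _ y x xy[symmetric]] by blast
  moreover have "f x \<in> topspace Y" "f y \<in> topspace Y"
    using f x y by (auto simp: continuous_map_def)
  ultimately show ?thesis
    using sep_class_imp_t0_space[OF Y] unfolding t0_space_def by blast
qed

theorem corollary3p2:
  fixes i :: nat
    and J :: "'j set"
    and S :: "'j \<Rightarrow> ('a, 'm) monoid_scheme"
    and T :: "'j \<Rightarrow> 'a topology"
    and R :: "'j \<Rightarrow> 'r topology"
    and \<phi> :: "'j \<Rightarrow> 'a \<Rightarrow> 'r"
    and P :: "'p topology"
    and \<psi> :: "('j \<Rightarrow> 'a) \<Rightarrow> 'p"
  assumes "i \<in> {0, 1, 2}"
    and "\<And>j. j \<in> J \<Longrightarrow> semitop_monoid_open_shifts (S j) (T j)"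
    and "\<And>j. j \<in> J \<Longrightarrow> reflection i (T j) (R j) (\<phi> j)"
    and "reflection i (product_topology T J) P \<psi>"
  shows "\<exists>k. (\<forall>x \<in> topspace (product_topology T J). k (\<psi> x) = (\<lambda>j\<in>J. \<phi> j (x j))) \<and>
             homeomorphic_map P (product_topology R J) k"
proof -
  let ?X = "product_topology T J" and ?Y = "product_topology R J"
  let ?\<Phi> = "\<lambda>x. \<lambda>j\<in>J. \<phi> j (x j)"
  have surj: "\<phi> j ` topspace (T j) = topspace (R j)" and cont: "continuous_map (T j) (R j) (\<phi> j)"
    if "j \<in> J" for j
    using assms(3)[OF that] by (simp_all add: reflection_def)
  have \<Phi>_surj: "?\<Phi> ` topspace ?X = topspace ?Y"
    using surj restrict_image_PiE[of \<phi> J "\<lambda>j. topspace (T j)"] by (simp cong: PiE_cong)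
  have \<Phi>_cont: "continuous_map ?X ?Y ?\<Phi>"
  proof (rule continuous_map_coordinatewise_then_product)
    fix j assume j: "j \<in> J"
    show "continuous_map ?X (R j) (\<lambda>x. ?\<Phi> x j)"
      using continuous_map_compose[OF continuous_map_product_coordinates[OF j, of T] cont[OF j]] j
      by (simp add: o_def)
  qed simp
  \<comment> \<open>Open shifts are used in each factor separately, since an infinite product need
    not have them.\<close>
  have "open_map ?X ?Y ?\<Phi>"
    by (rule open_map_product_topology)
      (simp_all add: semitop_monoid_open_shifts.reflection_open_map[OF assms(2,1,3)] surj)
  then have \<Phi>_quot: "quotient_map ?X ?Y ?\<Phi>"
    using \<Phi>_cont \<Phi>_surj by (intro continuous_open_imp_quotient_map)
  note \<psi>_surj = reflection_image[OF assms(4)]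
  have "sep_class i ?Y"
    using sep_class_product_topology[OF assms(1)] reflection_sep_class[OF assms(3)] by blast
  then obtain k where k: "continuous_map P ?Y k" "\<And>x. x \<in> topspace ?X \<Longrightarrow> ?\<Phi> x = k (\<psi> x)"
    by (rule reflection_factor[OF assms(4) _ \<Phi>_cont]) (rule that)
  have fibres: "\<psi> x = \<psi> y" if "x \<in> topspace ?X" "y \<in> topspace ?X" "?\<Phi> x = ?\<Phi> y" for x y
  proof (rule product_reflections_eq_imp_eq[OF assms(3) reflection_sep_class[OF assms(4)]
        reflection_continuous[OF assms(4)] that(1,2)])
    show "\<phi> j (x j) = \<phi> j (y j)" if "j \<in> J" for j
      using fun_cong[OF \<open>?\<Phi> x = ?\<Phi> y\<close>, of j] that by simp
  qed
  \<comment> \<open>The inverse of \<open>k\<close> is \<psi> lifted along the quotient map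
    \<open>?\<Phi>\<close>; surjectivity of \<psi> and \<open>?\<Phi>\<close> then yields both
    inverse laws.\<close>
  obtain g where g: "continuous_map ?Y P g" "\<And>x. x \<in> topspace ?X \<Longrightarrow> g (?\<Phi> x) = \<psi> x"
    by (rule quotient_map_lift_exists[OF \<Phi>_quot reflection_continuous[OF assms(4)] fibres])
      (assumption+, rule that)
  have "g (k p) = p" if "p \<in> \<psi> ` topspace ?X" for p
    using that by (rule imageE) (simp only: k(2)[symmetric] g(2))
  moreover have "k (g r) = r" if "r \<in> ?\<Phi> ` topspace ?X" for r
    using that by (rule imageE) (simp only: k(2)[symmetric] g(2))
  ultimately have "homeomorphic_maps P ?Y k g"
    unfolding homeomorphic_maps_def \<psi>_surj \<Phi>_surj using k(1) g(1) by blast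
  then have "homeomorphic_map P ?Y k"
    by (rule homeomorphic_maps_imp_map)
  then show ?thesis
    using k(2)[symmetric] by (intro exI[of _ k] conjI ballI)
qed

end
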